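(* For each finite $n\ge 2$, the variety generated by the involution semigroup $(\mathsf{baxt}_n,{}^{\sharp})$ contains continuum many subvarieties.
   Context: Baxter monoid: for $n\ge 1$ let $\mathcal{A}_n=\{1<2<\cdots<n\}$ and let $\mathcal{A}_n^{\star}$ be the free monoid on $\mathcal{A}_n$. Then $\mathsf{baxt}_n=\mathcal{A}_n^{\star}/\!\equiv$, where $\equiv$ is the congruence generated by all pairs $(c\mathbf{u}ad\mathbf{v}b,\ c\mathbf{u}da\mathbf{v}b)$ with $a\le b<c\le d$ and $(b\mathbf{u}da\mathbf{v}c,\ b\mathbf{u}ad\mathbf{v}c)$ with $a<b\le c<d$, where $a,b,c,d\in\mathcal{A}_n$, $\mathbf{u},\mathbf{v}\in\mathcal{A}_n^{\star}$. Schützenberger's involution $^{\sharp}$ on $\mathsf{baxt}_n$ is induced by $i^{\sharp}=n+1-i$ and $(w_1\cdots w_k)^{\sharp}=w_k^{\sharp}\cdots w_1^{\sharp}$. An involution semigroup is a semigroup with a unary operation $^*$ satisfying $(x^* )^*\approx x$ and $(xy)^*\approx y^*x^*$. The variety generated by $(S,{}^* )$ is the class of all involution semigroups satisfying every identity (in the operations of multiplication and $^*$) satisfied by $(S,{}^* )$; a subvariety is a subclass that is itself a variety. "Continuum many" means exactly $2^{\aleph_0}$. *)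

theory Defs
  imports "HOL-Algebra.Congruence" "HOL-Library.Equipollence"
begin

section \<open>Involution semigroups\<close>

record 'a inv_semigroup = "'a partial_object" +
  mul :: "'a \<Rightarrow> 'a \<Rightarrow> 'a" (infixl "\<odot>\<index>" 70)
  star :: "'a \<Rightarrow> 'a"

locale involution_semigroup =
  fixes S (structure)
  assumes nonempty: "carrier S \<noteq> {}"
    and mul_closed: "\<lbrakk>x \<in> carrier S; y \<in> carrier S\<rbrakk> \<Longrightarrow> x \<odot> y \<in> carrier S"
    and mul_assoc: "\<lbrakk>x \<in> carrier S; y \<in> carrier S; z \<in> carrier S\<rbrakk>
      \<Longrightarrow> (x \<odot> y) \<odot> z = x \<odot> (y \<odot> z)"
    and star_closed: "x \<in> carrier S \<Longrightarrow> star S x \<in> carrier S"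
    and star_star: "x \<in> carrier S \<Longrightarrow> star S (star S x) = x"
    and star_mul: "\<lbrakk>x \<in> carrier S; y \<in> carrier S\<rbrakk>
      \<Longrightarrow> star S (x \<odot> y) = star S y \<odot> star S x"

section \<open>Identities and varieties\<close>

datatype inv_term = Var nat | Mul inv_term inv_term | Star inv_term

primrec term_value :: "('a, 'm) inv_semigroup_scheme \<Rightarrow> (nat \<Rightarrow> 'a) \<Rightarrow> inv_term \<Rightarrow> 'a" where
  "term_value S f (Var i) = f i"
| "term_value S f (Mul s t) = mul S (term_value S f s) (term_value S f t)"
| "term_value S f (Star t) = star S (term_value S f t)"

definition satisfies :: "('a, 'm) inv_semigroup_scheme \<Rightarrow> inv_term \<times> inv_term \<Rightarrow> bool" where
  "satisfies S e \<longleftrightarrow>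
     (\<forall>f. range f \<subseteq> carrier S \<longrightarrow> term_value S f (fst e) = term_value S f (snd e))"

definition identities :: "('a, 'm) inv_semigroup_scheme \<Rightarrow> (inv_term \<times> inv_term) set" where
  "identities S = {e. satisfies S e}"

text \<open>
  HOL has no class of all involution semigroups, so classes are taken relative to a type
  \<^typ>\<open>'a\<close>: they consist of the involution semigroups whose carrier is any nonempty subset of
  \<^typ>\<open>'a\<close>. A variety is determined by its countable members (it is generated by its free
  algebra on countably many generators), so for infinite \<^typ>\<open>'a\<close> the varieties below
  correspond one-to-one, and compatibly with inclusion, to the varieties of all involution semigroups. The values of the
  operations outside the carrier have no effect on membership in any of these classes.
\<close>

definition models :: "(inv_term \<times> inv_term) set \<Rightarrow> 'a inv_semigroup set" where
  "models E = {S. involution_semigroup S \<and> (\<forall>e\<in>E. satisfies S e)}"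

definition variety :: "'a inv_semigroup set \<Rightarrow> bool" where
  "variety V \<longleftrightarrow> (\<exists>E. V = models E)"

text \<open>The generating algebra need not live on the type \<^typ>\<open>'a\<close>.\<close>

definition generated_variety :: "('b, 'm) inv_semigroup_scheme \<Rightarrow> 'a inv_semigroup set" where
  "generated_variety S = models (identities S)"

definition subvarieties :: "'a inv_semigroup set \<Rightarrow> 'a inv_semigroup set set" where
  "subvarieties V = {W. W \<subseteq> V \<and> variety W}"

section \<open>The Baxter monoid with Schuetzenberger's involution\<close>

text \<open>The congruence on the free monoid \<^term>\<open>lists A\<close> generated by the relation \<open>R\<close>.\<close>

inductive_set free_congruence :: "'a set \<Rightarrow> ('a list \<times> 'a list) set \<Rightarrow> ('a list \<times> 'a list) set"
  for A :: "'a set" and R :: "('a list \<times> 'a list) set" where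
  gen: "\<lbrakk>(x, y) \<in> R; x \<in> lists A; y \<in> lists A\<rbrakk> \<Longrightarrow> (x, y) \<in> free_congruence A R"
| refl: "x \<in> lists A \<Longrightarrow> (x, x) \<in> free_congruence A R"
| sym: "(x, y) \<in> free_congruence A R \<Longrightarrow> (y, x) \<in> free_congruence A R"
| trans: "\<lbrakk>(x, y) \<in> free_congruence A R; (y, z) \<in> free_congruence A R\<rbrakk>
    \<Longrightarrow> (x, z) \<in> free_congruence A R"
| app: "\<lbrakk>(x, y) \<in> free_congruence A R; (x', y') \<in> free_congruence A R\<rbrakk>
    \<Longrightarrow> (x @ x', y @ y') \<in> free_congruence A R"

definition baxt_relations :: "nat \<Rightarrow> (nat list \<times> nat list) set" where
  "baxt_relations n =
     {([c] @ u @ [a, d] @ v @ [b], [c] @ u @ [d, a] @ v @ [b]) | a b c d u v.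
        {a, b, c, d} \<subseteq> {1..n} \<and> u \<in> lists {1..n} \<and> v \<in> lists {1..n} \<and>
        a \<le> b \<and> b < c \<and> c \<le> d}
   \<union> {([b] @ u @ [d, a] @ v @ [c], [b] @ u @ [a, d] @ v @ [c]) | a b c d u v.
        {a, b, c, d} \<subseteq> {1..n} \<and> u \<in> lists {1..n} \<and> v \<in> lists {1..n} \<and>
        a < b \<and> b \<le> c \<and> c < d}"

definition baxt_congruence :: "nat \<Rightarrow> (nat list \<times> nat list) set" where
  "baxt_congruence n = free_congruence {1..n} (baxt_relations n)"

definition sharp_word :: "nat \<Rightarrow> nat list \<Rightarrow> nat list" where
  "sharp_word n w = rev (map (\<lambda>i. n + 1 - i) w)"

definition baxt :: "nat \<Rightarrow> nat list set inv_semigroup" where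
  "baxt n =
    \<lparr>carrier = lists {1..n} // baxt_congruence n,
     mul = (\<lambda>X Y. \<Union>x\<in>X. \<Union>y\<in>Y. baxt_congruence n `` {x @ y}),
     star = (\<lambda>X. \<Union>x\<in>X. baxt_congruence n `` {sharp_word n x})\<rparr>"

lemma free_congruence_lists:
  "(x, y) \<in> free_congruence A R \<Longrightarrow> x \<in> lists A \<and> y \<in> lists A"
  by (induction rule: free_congruence.induct) auto

lemma equiv_baxt_congruence: "equiv (lists {1..n}) (baxt_congruence n)"
  unfolding baxt_congruence_def
proof (rule equivI)
  show "free_congruence {1..n} (baxt_relations n) \<subseteq> lists {1..n} \<times> lists {1..n}"
    by (rule subrelI) (use free_congruence_lists in fast)
  show "refl_on (lists {1..n}) (free_congruence {1..n} (baxt_relations n))"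
    by (rule refl_onI) (rule free_congruence.refl)
  show "sym (free_congruence {1..n} (baxt_relations n))"
    by (rule symI) (rule free_congruence.sym)
  show "trans (free_congruence {1..n} (baxt_relations n))"
    by (rule transI) (rule free_congruence.trans)
qed

lemma sharp_word_lists: "w \<in> lists {1..n} \<Longrightarrow> sharp_word n w \<in> lists {1..n}"
  by (fastforce simp: sharp_word_def in_lists_conv_set)

lemma sharp_word_sharp_word: "w \<in> lists {1..n} \<Longrightarrow> sharp_word n (sharp_word n w) = w"
  by (auto simp: sharp_word_def rev_map in_lists_conv_set intro!: map_idI)

lemma sharp_word_append: "sharp_word n (x @ y) = sharp_word n y @ sharp_word n x"
  by (simp add: sharp_word_def)

lemma baxt_relations_1:
  assumes "{a, b, c, d} \<subseteq> {1..n}" "u \<in> lists {1..n}" "v \<in> lists {1..n}" "a \<le> b" "b < c" "c \<le> d"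
  shows "([c] @ u @ [a, d] @ v @ [b], [c] @ u @ [d, a] @ v @ [b]) \<in> baxt_relations n"
  unfolding baxt_relations_def using assms by blast

lemma baxt_relations_2:
  assumes "{a, b, c, d} \<subseteq> {1..n}" "u \<in> lists {1..n}" "v \<in> lists {1..n}" "a < b" "b \<le> c" "c < d"
  shows "([b] @ u @ [d, a] @ v @ [c], [b] @ u @ [a, d] @ v @ [c]) \<in> baxt_relations n"
  unfolding baxt_relations_def using assms by blast

lemma baxt_relations_sharp:
  assumes "(x, y) \<in> baxt_relations n"
  shows "(sharp_word n x, sharp_word n y) \<in> baxt_relations n"
  using assms[unfolded baxt_relations_def]
proof (elim UnE CollectE exE conjE Pair_inject)
  fix a b c d u v
  assume xy: "x = [c] @ u @ [a, d] @ v @ [b]" "y = [c] @ u @ [d, a] @ v @ [b]"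
    and abcd: "{a, b, c, d} \<subseteq> {1..n}" "a \<le> b" "b < c" "c \<le> d"
    and uv: "u \<in> lists {1..n}" "v \<in> lists {1..n}"
  have "{n + 1 - d, n + 1 - c, n + 1 - b, n + 1 - a} \<subseteq> {1..n}"
    "n + 1 - d \<le> n + 1 - c" "n + 1 - c < n + 1 - b" "n + 1 - b \<le> n + 1 - a"
    using abcd by auto
  from baxt_relations_1[OF this(1) sharp_word_lists[OF uv(2)] sharp_word_lists[OF uv(1)] this(2-4)]
  show ?thesis by (simp add: xy sharp_word_def)
next
  fix a b c d u v
  assume xy: "x = [b] @ u @ [d, a] @ v @ [c]" "y = [b] @ u @ [a, d] @ v @ [c]"
    and abcd: "{a, b, c, d} \<subseteq> {1..n}" "a < b" "b \<le> c" "c < d"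
    and uv: "u \<in> lists {1..n}" "v \<in> lists {1..n}"
  have "{n + 1 - d, n + 1 - c, n + 1 - b, n + 1 - a} \<subseteq> {1..n}"
    "n + 1 - d < n + 1 - c" "n + 1 - c \<le> n + 1 - b" "n + 1 - b < n + 1 - a"
    using abcd by auto
  from baxt_relations_2[OF this(1) sharp_word_lists[OF uv(2)] sharp_word_lists[OF uv(1)] this(2-4)]
  show ?thesis by (simp add: xy sharp_word_def)
qed

lemma baxt_congruence_sharp:
  assumes "(x, y) \<in> baxt_congruence n"
  shows "(sharp_word n x, sharp_word n y) \<in> baxt_congruence n"
  using assms unfolding baxt_congruence_def
proof (induction rule: free_congruence.induct)
  case (gen x y)
  then show ?case by (intro free_congruence.gen baxt_relations_sharp sharp_word_lists)
next
  case (refl x)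
  then show ?case by (intro free_congruence.refl sharp_word_lists)
next
  case (sym x y)
  show ?case by (rule free_congruence.sym) (rule sym.IH)
next
  case (trans x y z)
  show ?case by (rule free_congruence.trans) (rule trans.IH)+
next
  case (app x y x' y')
  then show ?case by (simp add: sharp_word_append free_congruence.app)
qed

lemma baxt_mul_class:
  assumes "x \<in> lists {1..n}" "y \<in> lists {1..n}"
  shows "mul (baxt n) (baxt_congruence n `` {x}) (baxt_congruence n `` {y})
       = baxt_congruence n `` {x @ y}"
proof -
  have "congruent2 (baxt_congruence n) (baxt_congruence n) (\<lambda>x y. baxt_congruence n `` {x @ y})"
    by (intro congruent2I' equiv_class_eq[OF equiv_baxt_congruence])
      (simp add: baxt_congruence_def free_congruence.app)
  from UN_equiv_class2[OF equiv_baxt_congruence equiv_baxt_congruence this assms]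
  show ?thesis by (simp add: baxt_def)
qed

lemma baxt_star_class:
  assumes "x \<in> lists {1..n}"
  shows "star (baxt n) (baxt_congruence n `` {x}) = baxt_congruence n `` {sharp_word n x}"
proof -
  have "(\<lambda>x. baxt_congruence n `` {sharp_word n x}) respects baxt_congruence n"
    by (intro congruentI equiv_class_eq[OF equiv_baxt_congruence] baxt_congruence_sharp)
  from UN_equiv_class[OF equiv_baxt_congruence this assms]
  show ?thesis by (simp add: baxt_def)
qed

lemma involution_semigroup_baxt: "involution_semigroup (baxt n)"
proof -
  define L where "L = lists {1..n}"
  have car: "carrier (baxt n) = (\<lambda>x. baxt_congruence n `` {x}) ` L"
    by (auto simp: baxt_def quotient_def L_def)
  have app: "x @ y \<in> L" if "x \<in> L" "y \<in> L" for x y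
    using that by (simp add: L_def)
  note class_simps = baxt_mul_class[of _ n, folded L_def] baxt_star_class[of _ n, folded L_def]
    sharp_word_lists[of _ n, folded L_def] sharp_word_sharp_word[of _ n, folded L_def]
    sharp_word_append app
  have ex_rep: "\<exists>x\<in>L. X = baxt_congruence n `` {x}" if "X \<in> carrier (baxt n)" for X
    using that unfolding car by blast
  have class_in: "baxt_congruence n `` {x} \<in> carrier (baxt n)" if "x \<in> L" for x
    using that unfolding car by blast
  show ?thesis
  proof
    show "carrier (baxt n) \<noteq> {}"
      unfolding car by (auto simp: L_def)
  next
    fix X Y assume "X \<in> carrier (baxt n)" "Y \<in> carrier (baxt n)"
    then obtain x y where L: "x \<in> L" "y \<in> L"
      and XY: "X = baxt_congruence n `` {x}" "Y = baxt_congruence n `` {y}"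
      by (metis ex_rep)
    show "mul (baxt n) X Y \<in> carrier (baxt n)"
      "star (baxt n) (mul (baxt n) X Y) = mul (baxt n) (star (baxt n) Y) (star (baxt n) X)"
      unfolding XY by (simp_all only: L class_simps class_in)
  next
    fix X Y Z assume "X \<in> carrier (baxt n)" "Y \<in> carrier (baxt n)" "Z \<in> carrier (baxt n)"
    then obtain x y z where L: "x \<in> L" "y \<in> L" "z \<in> L"
      and XYZ: "X = baxt_congruence n `` {x}" "Y = baxt_congruence n `` {y}"
        "Z = baxt_congruence n `` {z}"
      by (metis ex_rep)
    show "mul (baxt n) (mul (baxt n) X Y) Z = mul (baxt n) X (mul (baxt n) Y Z)"
      unfolding XYZ by (simp only: L class_simps append_assoc)
  next
    fix X assume "X \<in> carrier (baxt n)"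
    then obtain x where L: "x \<in> L" and X: "X = baxt_congruence n `` {x}"
      by (metis ex_rep)
    show "star (baxt n) X \<in> carrier (baxt n)" "star (baxt n) (star (baxt n) X) = X"
      unfolding X by (simp_all only: L class_simps class_in)
  qed
qed

end

(*
  The invariants "content, number of leading letters 1, number of trailing letters n" of baxt n show
  that a word without starred letters in which every letter occurs at most twice is an isoterm for
  (baxt n, sharp): it forms no nontrivial identity with any other word. Hence the nilpotent
  involution semigroup of all factors of such a word w and of its star, with all other words
  collapsed to 0, belongs to the generated variety. For the words
  w_r = 0 1 2 ... (2r+1) 0 2 4 ... 2r 1 3 ... (2r+1), no factor of w_r is a substitution instance of
  w_q for q \<noteq> r: such an instance contains every one of its letters twice, which forces it to be
  all of w_r, and since no factor of length 2 occurs twice in w_r it has the length of w_q. So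
  w_q = w_q w_q holds in the semigroup of w_r for q \<noteq> r, both sides being 0, but fails for q = r, and
  different sets of these identities define different subvarieties. There are at most continuum many
  subvarieties because there are only countably many identities.
*)

theory Submission
  imports Defs "HOL-Library.Countable" "HOL-Library.Sublist" "HOL-Library.Multiset"
begin

section \<open>Words determined by their two-letter projections\<close>

text \<open>The first letters \<open>a\<close> and \<open>b\<close> of the two words both survive in
  the projection to \<open>{a, b}\<close>, so they agree; cancelling them preserves the
  hypothesis.\<close>

lemma eq_if_filter_pairs_eq:
  assumes "\<And>x y. filter (\<lambda>z. z \<in> {x, y}) U = filter (\<lambda>z. z \<in> {x, y}) V"
  shows "U = V"
  using assms
proof (induction U arbitrary: V)
  case Nil
  have "x \<notin> set V" for x
    using Nil[of x x] by (metis filter.simps(1) filter_empty_conv insertI1)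
  then show ?case by (metis list.set_intros(1) neq_Nil_conv)
next
  case (Cons a U)
  obtain b V' where V: "V = b # V'"
  proof (cases V)
    case Nil
    then show thesis using Cons.prems[of a a] by simp
  qed
  have "a = b"
    using Cons.prems[of a b] by (simp add: V)
  moreover have "U = V'"
  proof (rule Cons.IH)
    fix x y
    show "filter (\<lambda>z. z \<in> {x, y}) U = filter (\<lambda>z. z \<in> {x, y}) V'"
      using Cons.prems[of x y] by (auto simp: V \<open>a = b\<close> split: if_splits)
  qed
  ultimately show ?case by (simp add: V)
qed

lemma replicate_if_set_subset: "set W \<subseteq> {p} \<Longrightarrow> W = replicate (length W) p"
  by (metis replicate_length_same singletonD subsetD)

text \<open>The leading block of \<open>p\<close> locates the first \<open>q\<close>, the trailing
  block the last one. With at most two \<open>q\<close> no other position is open, and the content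
  gives the number of \<open>p\<close> in between.\<close>

lemma two_letter_word_eq:
  assumes "p \<noteq> q" "set U \<subseteq> {p, q}" "set V \<subseteq> {p, q}" "mset U = mset V" "count_list U q \<le> 2"
    and "takeWhile (\<lambda>z. z = p) U = takeWhile (\<lambda>z. z = p) V"
    and "takeWhile (\<lambda>z. z = p) (rev U) = takeWhile (\<lambda>z. z = p) (rev V)"
  shows "U = V"
proof -
  define t where "t = takeWhile (\<lambda>z. z = p) U"
  define t' where "t' = takeWhile (\<lambda>z. z = p) (rev U)"
  \<comment> \<open>Cases by the number of \<open>q\<close> in \<open>W\<close>: none, one, or at
    least two. In the last case \<open>s\<close> lies between the first and the last
    \<open>q\<close> and may still contain \<open>q\<close>; the count excludes this later.\<close>
  have form: "W = t \<and> count_list W q = 0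
      \<or> W = t @ q # rev t' \<and> count_list W q = 1
      \<or> (\<exists>s. W = t @ q # s @ q # rev t' \<and> count_list W q = 2 + count_list s q)"
    if W: "set W \<subseteq> {p, q}" "takeWhile (\<lambda>z. z = p) W = t" "takeWhile (\<lambda>z. z = p) (rev W) = t'" for W
  proof (cases "q \<in> set W")
    case False
    then have "\<forall>z\<in>set W. z = p" using W by auto
    then have "takeWhile (\<lambda>z. z = p) W = W" by simp
    then show ?thesis using W False by simp
  next
    case True
    then obtain a s where as: "W = a @ q # s" "q \<notin> set a"
      by (meson split_list_first)
    have a: "a = t" "\<forall>z\<in>set a. z = p"
      using W as \<open>p \<noteq> q\<close> by (auto simp: takeWhile_append)
    show ?thesis
    proof (cases "q \<in> set s")
      case False
      then have "\<forall>z\<in>set s. z = p" using W as by auto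
      then have "rev s = t'"
        using W as \<open>p \<noteq> q\<close> by (simp add: takeWhile_append)
      then show ?thesis
        using a as \<open>p \<noteq> q\<close> False by (metis One_nat_def add.commute append_Nil count_list.simps(2)
            count_list_append count_notin plus_1_eq_Suc rev_rev_ident)
    next
      case True
      then obtain b r where br: "s = b @ q # r" "q \<notin> set r"
        by (meson split_list_last)
      then have "\<forall>z\<in>set r. z = p" using W as by auto
      then have "rev r = t'"
        using W as br \<open>p \<noteq> q\<close> by (simp add: takeWhile_append)
      then have "W = t @ q # b @ q # rev t'" using as a br by auto
      then show ?thesis
        using as(2) a br \<open>rev r = t'\<close> by (auto simp: count_notin)
    qed
  qed
  note formU = form[OF assms(2) t_def[symmetric] t'_def[symmetric]]
  note formV = form[OF assms(3) assms(6)[folded t_def, symmetric] assms(7)[folded t'_def, symmetric]]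
  have cnt: "count_list V q = count_list U q"
    using \<open>mset U = mset V\<close> by (metis count_mset)
  consider "count_list U q = 0" | "count_list U q = 1" | "count_list U q = 2"
    using assms(5) by linarith
  then show ?thesis
  proof cases
    case 1
    then have "U = t" "V = t" using formU formV cnt by auto
    then show ?thesis by simp
  next
    case 2
    then have "U = t @ q # rev t'" "V = t @ q # rev t'" using formU formV cnt by auto
    then show ?thesis by simp
  next
    case 3
    then obtain s s' where s: "U = t @ q # s @ q # rev t'" "count_list s q = 0"
      and s': "V = t @ q # s' @ q # rev t'" "count_list s' q = 0"
      using formU formV cnt by auto
    have "set s \<subseteq> {p}" "set s' \<subseteq> {p}"
      using s s' assms(2,3) by (auto simp: count_list_0_iff)
    moreover have "length s = length s'"
      using mset_eq_length[OF \<open>mset U = mset V\<close>] s(1) s'(1) by simp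
    ultimately have "s = s'" by (metis replicate_if_set_subset)
    then show ?thesis using s s' by simp
  qed
qed

section \<open>The words w_r and their factors\<close>

text \<open>The word 0 2 4 ... 2r 1 3 ... 2r+1: a rearrangement of 0 1 ... 2r+1 that keeps the first
  and the last letter but, for r at least 1, destroys every adjacency a, a+1.\<close>

definition evens_then_odds :: "nat \<Rightarrow> nat list" where
  "evens_then_odds r = map (\<lambda>i. if i \<le> r then 2 * i else 2 * (i - r) - 1) [0..<2 * r + 2]"

definition double_word :: "nat \<Rightarrow> nat list" where
  "double_word r = [0..<2 * r + 2] @ evens_then_odds r"

lemma count_list_distinct: "distinct xs \<Longrightarrow> count_list xs x = (if x \<in> set xs then 1 else 0)"
  by (induction xs) auto

lemma count_list_ge_1: "x \<in> set xs \<Longrightarrow> 1 \<le> count_list xs x"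
  by (metis count_list_0_iff less_one not_le)

lemma evens_then_odds_nonempty: "evens_then_odds r \<noteq> []"
  by (simp add: evens_then_odds_def)

lemma hd_evens_then_odds: "hd (evens_then_odds r) = 0"
  by (simp add: evens_then_odds_def hd_map del: upt_Suc)

lemma last_evens_then_odds: "last (evens_then_odds r) = 2 * r + 1"
  by (simp add: evens_then_odds_def)

lemma distinct_evens_then_odds: "distinct (evens_then_odds r)"
  unfolding evens_then_odds_def distinct_map
  by (auto simp: inj_on_def split: if_splits) presburger+

lemma set_evens_then_odds: "set (evens_then_odds r) = {0..<2 * r + 2}"
proof (rule card_subset_eq)
  show "set (evens_then_odds r) \<subseteq> {0..<2 * r + 2}"
    by (auto simp: evens_then_odds_def)
  show "card (set (evens_then_odds r)) = card {0..<2 * r + 2}"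
    by (simp only: distinct_card[OF distinct_evens_then_odds]) (simp add: evens_then_odds_def)
qed simp

text \<open>Neighbours differ by 2, except for the descent from 2r to 1; for r = 0 that place reads
  0 1.\<close>

lemma evens_then_odds_no_consecutive:
  assumes "1 \<le> r"
  shows "evens_then_odds r \<noteq> X @ a # Suc a # Y"
proof
  assume eq: "evens_then_odds r = X @ a # Suc a # Y"
  define i where "i = length X"
  have "length (evens_then_odds r) = 2 * r + 2"
    by (simp add: evens_then_odds_def)
  then have i: "Suc i < 2 * r + 2"
    by (simp add: eq i_def)
  have "evens_then_odds r ! i = a" "evens_then_odds r ! Suc i = Suc a"
    by (simp_all add: eq i_def nth_append)
  then show False
    using i assms unfolding evens_then_odds_def
    by (simp del: upt_Suc split: if_splits)
qed

lemma count_list_double_word: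
  "count_list (double_word r) x = (if x < 2 * r + 2 then 2 else 0)"
  unfolding double_word_def count_list_append
  by (simp only: count_list_distinct distinct_evens_then_odds distinct_upt set_evens_then_odds set_upt) auto

lemma count_list_double_word_le: "count_list (double_word r) x \<le> 2"
  by (simp add: count_list_double_word)

lemma length_double_word: "length (double_word r) = 4 * r + 4"
  by (simp add: double_word_def evens_then_odds_def)

text \<open>Each half of w_r has distinct letters, so \<open>f\<close> must overlap both. Its part
  in the second half starts with 0, so both occurrences of 0 lie in \<open>f\<close> and nothing
  precedes it; dually, the letter 2r+1 shows that nothing follows it.\<close>

lemma double_word_factor_eq:
  assumes "double_word r = X @ f @ Y" "f \<noteq> []" "\<And>x. x \<in> set f \<Longrightarrow> 2 \<le> count_list f x"
  shows "X = [] \<and> Y = []"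
proof -
  define A where "A = [0..<2 * r + 2]"
  define B where "B = evens_then_odds r"
  have AB: "A \<noteq> []" "B \<noteq> []" "hd A = hd B" "last A = last B"
    by (simp_all add: A_def B_def evens_then_odds_nonempty hd_evens_then_odds last_evens_then_odds hd_upt del: upt_Suc)
  have dist: "distinct A" "distinct B"
    by (simp_all add: A_def B_def distinct_evens_then_odds)
  \<comment> \<open>Excludes that \<open>f\<close> lies inside a single half.\<close>
  have not_sub: "\<not> distinct (X' @ f @ Y')" for X' Y'
  proof
    assume "distinct (X' @ f @ Y')"
    then have "count_list f (hd f) \<le> 1" by (simp add: count_list_distinct)
    then show False using assms(3)[of "hd f"] assms(2) by simp
  qed
  have eq: "A @ B = X @ (f @ Y)"
    using assms(1) by (simp add: double_word_def A_def B_def)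
  have cnt: "count_list X x + count_list f x + count_list Y x \<le> 2" for x
    using count_list_double_word_le[of r x] by (simp add: assms(1) del: count_list_append)
      (simp add: add.assoc)
  obtain f1 f2 where f: "A = X @ f1" "B = f2 @ Y" "f = f1 @ f2"
  proof -
    consider us where "A = X @ us" "us @ B = f @ Y" | us where "A @ us = X" "B = us @ f @ Y"
      using eq by (auto simp: append_eq_append_conv2)
    then show thesis
    proof cases
      case 1
      then consider vs where "us = f @ vs" "vs @ B = Y" | vs where "us @ vs = f" "B = vs @ Y"
        by (auto simp: append_eq_append_conv2)
      then show thesis
      proof cases
        case 1
        then show thesis using \<open>A = X @ us\<close> dist not_sub by metis
      next
        case 2
        then show thesis using \<open>A = X @ us\<close> that by metis
      qed
    next
      case 2
      then show thesis using dist not_sub by metis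
    qed
  qed
  have "f1 \<noteq> []" "f2 \<noteq> []"
    using f dist not_sub by (metis append_Nil append_Nil2)+
  have "X = []"
  proof (rule ccontr)
    assume "X \<noteq> []"
    then have "hd B \<in> set X" using AB f by (metis hd_append2 hd_in_set)
    moreover have "hd B \<in> set f" using f \<open>f2 \<noteq> []\<close> by (simp add: hd_append)
    ultimately show False
      using assms(3)[of "hd B"] cnt[of "hd B"] count_list_ge_1[of "hd B" X] by linarith
  qed
  moreover have "Y = []"
  proof (rule ccontr)
    assume "Y \<noteq> []"
    then have "last A \<in> set Y" using AB f by (metis last_appendR last_in_set)
    moreover have "last A \<in> set f" using f \<open>f1 \<noteq> []\<close> by simp
    ultimately show False
      using assms(3)[of "last A"] cnt[of "last A"] count_list_ge_1[of "last A" Y] by linarith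
  qed
  ultimately show ?thesis by simp
qed

text \<open>As each half has distinct letters, the two occurrences lie in different halves and
  neither crosses the middle. The first forces \<open>b = Suc a\<close>, and the second half has no
  such neighbours.\<close>

lemma double_word_no_repeated_pair:
  assumes "1 \<le> r"
  shows "double_word r \<noteq> X @ [a, b] @ Y @ [a, b] @ Z"
proof
  assume eq: "double_word r = X @ [a, b] @ Y @ [a, b] @ Z"
  define w where "w = double_word r"
  define i where "i = length X"
  define j where "j = length (X @ [a, b] @ Y)"
  define m where "m = 2 * r + 2"
  have ij: "i + 2 \<le> j" "Suc j < length w"
    by (simp_all add: i_def j_def w_def eq)
  have nths: "w ! i = a" "w ! Suc i = b" "w ! j = a" "w ! Suc j = b"
    by (simp_all add: i_def j_def w_def eq nth_append)
  have len: "length w = 2 * m"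
    by (simp add: w_def length_double_word m_def)
  have wA: "w ! k = k" if "k < m" for k
    using that by (simp add: w_def double_word_def nth_append m_def del: upt_Suc)
  have wB: "w ! k = evens_then_odds r ! (k - m)" if "m \<le> k" for k
    using that by (simp add: w_def double_word_def nth_append m_def del: upt_Suc)
  have lenB: "length (evens_then_odds r) = m"
    by (simp add: evens_then_odds_def m_def)
  have injB: "k = l" if "m \<le> k" "m \<le> l" "k < 2 * m" "l < 2 * m" "w ! k = w ! l" for k l
    using that distinct_evens_then_odds[of r] wB lenB by (simp add: distinct_conv_nth) (metis
        add.commute diff_less_mono le_add_diff_inverse mult_2 add_diff_cancel_left')
  have "i < m" using injB[of i j] ij nths len by linarith
  have "m \<le> j" using wA[of i] wA[of j] ij nths \<open>i < m\<close> by linarith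
  have "Suc i < m"
    using injB[of "Suc i" "Suc j"] ij nths len \<open>m \<le> j\<close> by linarith
  then have "b = Suc a"
    using wA[of i] wA[of "Suc i"] nths by simp
  have "evens_then_odds r = take (j - m) (evens_then_odds r) @ a # Suc a # drop (Suc (Suc (j - m))) (evens_then_odds r)"
    using nths wB[of j] wB[of "Suc j"] ij len lenB \<open>m \<le> j\<close> \<open>b = Suc a\<close>
    by (metis Cons_nth_drop_Suc Suc_diff_le Suc_leI Suc_lessD append_take_drop_id
        diff_less_mono le_Suc_eq mult_2 add_diff_cancel_left')
  then show False
    using evens_then_odds_no_consecutive[OF assms] by blast
qed

lemma count_list_concat_map_ge:
  assumes "x \<in> set (\<phi> i)"
  shows "count_list p i \<le> count_list (concat (map \<phi> p)) x"
proof (induction p)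
  case (Cons j p)
  then show ?case using count_list_ge_1[OF assms] by auto
qed simp

lemma two_occurrences:
  assumes "2 \<le> count_list p i"
  shows "\<exists>p1 p2 p3. p = p1 @ i # p2 @ i # p3"
proof -
  have "i \<in> set p" using assms by (metis count_notin not_numeral_le_zero)
  then obtain p1 q where q: "p = p1 @ i # q" "i \<notin> set p1" by (meson split_list_first)
  then have "i \<in> set q" using assms by (metis Suc_1 add_0 count_list.simps(2) count_list_append
        count_notin not_less_eq_eq le_numeral_extra(3) add.commute plus_1_eq_Suc)
  then show ?thesis using q by (metis split_list)
qed

text \<open>An instance inherits the doubling of letters, so it is all of w_r. A variable with an
  image of length at least 2 would repeat a factor of length 2, so every image is a letter and the
  lengths agree. The word \<open>p\<close> is kept general in order to cover both w_q and its
  reversal.\<close>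

lemma double_word_instance_free:
  assumes "1 \<le> r" and p: "p \<noteq> []" "\<And>i. i \<in> set p \<Longrightarrow> 2 \<le> count_list p i"
    and "length p \<noteq> length (double_word r)" and ne: "\<And>i. \<phi> i \<noteq> []"
  shows "\<not> sublist (concat (map \<phi> p)) (double_word r)"
proof
  assume "sublist (concat (map \<phi> p)) (double_word r)"
  then obtain X Y where eq: "double_word r = X @ concat (map \<phi> p) @ Y"
    by (auto simp: sublist_def)
  have "X = [] \<and> Y = []"
  proof (rule double_word_factor_eq[OF eq])
    show "concat (map \<phi> p) \<noteq> []" using p ne by (cases p) auto
    fix x assume "x \<in> set (concat (map \<phi> p))"
    then obtain i where "i \<in> set p" "x \<in> set (\<phi> i)" by auto
    then show "2 \<le> count_list (concat (map \<phi> p)) x"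
      using p(2) count_list_concat_map_ge le_trans by metis
  qed
  then have eq: "double_word r = concat (map \<phi> p)" using eq by simp
  have "length (\<phi> i) = 1" if i: "i \<in> set p" for i
  proof (rule ccontr)
    assume "length (\<phi> i) \<noteq> 1"
    then obtain a b s where s: "\<phi> i = a # b # s"
      using ne[of i] by (metis One_nat_def length_Cons list.size(3) neq_Nil_conv)
    obtain p1 p2 p3 where "p = p1 @ i # p2 @ i # p3"
      using two_occurrences[OF p(2)[OF i]] by blast
    then have "double_word r = concat (map \<phi> p1) @ [a, b] @ (s @ concat (map \<phi> p2)) @ [a, b] @
        (s @ concat (map \<phi> p3))"
      by (simp add: eq s)
    then show False using double_word_no_repeated_pair[OF assms(1)] by blast
  qed
  then have "length (concat (map \<phi> p)) = length p"
    by (induction p) auto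
  then show False using assms(4) eq by simp
qed

section \<open>Homomorphisms, quotients and free involution semigroups\<close>

definition inv_hom :: "('a, 'm) inv_semigroup_scheme \<Rightarrow> ('b, 'k) inv_semigroup_scheme \<Rightarrow> ('a \<Rightarrow> 'b) \<Rightarrow> bool" where
  "inv_hom S T h \<longleftrightarrow> h ` carrier S \<subseteq> carrier T
     \<and> (\<forall>x\<in>carrier S. \<forall>y\<in>carrier S. h (mul S x y) = mul T (h x) (h y))
     \<and> (\<forall>x\<in>carrier S. h (star S x) = star T (h x))"

lemma term_value_closed:
  assumes "involution_semigroup S" "range f \<subseteq> carrier S"
  shows "term_value S f t \<in> carrier S"
proof -
  interpret involution_semigroup S by (rule assms)
  show ?thesis using assms(2) by (induction t) (auto simp: mul_closed star_closed)
qed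

lemma term_value_hom:
  assumes "involution_semigroup S" "inv_hom S T h" "range f \<subseteq> carrier S"
  shows "term_value T (h \<circ> f) t = h (term_value S f t)"
  using assms(2) term_value_closed[OF assms(1,3)] by (induction t) (auto simp: inv_hom_def)

text \<open>The kernel of \<open>h\<close> is a congruence of \<open>S\<close>.\<close>

definition op_compatible :: "('a, 'm) inv_semigroup_scheme \<Rightarrow> ('a \<Rightarrow> 'b) \<Rightarrow> bool" where
  "op_compatible S h \<longleftrightarrow>
     (\<forall>x\<in>carrier S. \<forall>x'\<in>carrier S. \<forall>y\<in>carrier S. \<forall>y'\<in>carrier S.
        h x = h x' \<longrightarrow> h y = h y' \<longrightarrow> h (mul S x y) = h (mul S x' y'))
   \<and> (\<forall>x\<in>carrier S. \<forall>x'\<in>carrier S. h x = h x' \<longrightarrow> h (star S x) = h (star S x'))"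

text \<open>The quotient of \<open>S\<close> by the kernel of \<open>h\<close>, realised on the
  values of \<open>h\<close> so that it can live on any type; \<open>inv_into\<close> chooses
  representatives.\<close>

definition image_semigroup :: "('a, 'm) inv_semigroup_scheme \<Rightarrow> ('a \<Rightarrow> 'b) \<Rightarrow> 'b inv_semigroup" where
  "image_semigroup S h =
     \<lparr>carrier = h ` carrier S,
      mul = (\<lambda>a b. h (mul S (inv_into (carrier S) h a) (inv_into (carrier S) h b))),
      star = (\<lambda>a. h (star S (inv_into (carrier S) h a)))\<rparr>"

lemma inv_hom_image_semigroup:
  assumes "op_compatible S h"
  shows "inv_hom S (image_semigroup S h) h"
proof -
  define r where "r a = inv_into (carrier S) h a" for a
  have r: "r (h x) \<in> carrier S" "h (r (h x)) = h x" if "x \<in> carrier S" for x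
    using that by (auto simp: r_def f_inv_into_f inv_into_into)
  have T: "image_semigroup S h = \<lparr>carrier = h ` carrier S,
      mul = (\<lambda>a b. h (mul S (r a) (r b))), star = (\<lambda>a. h (star S (r a)))\<rparr>"
    by (simp add: image_semigroup_def r_def)
  have "h (mul S x y) = h (mul S (r (h x)) (r (h y)))" if "x \<in> carrier S" "y \<in> carrier S" for x y
    using assms r that unfolding op_compatible_def by metis
  moreover have "h (star S x) = h (star S (r (h x)))" if "x \<in> carrier S" for x
    using assms r that unfolding op_compatible_def by metis
  ultimately show ?thesis
    unfolding inv_hom_def T by simp
qed

lemma involution_semigroup_image:
  assumes "involution_semigroup S" "op_compatible S h"
  shows "involution_semigroup (image_semigroup S h)"
proof -
  interpret involution_semigroup S by (rule assms)
  have mul_h: "mul (image_semigroup S h) (h x) (h y) = h (mul S x y)"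
    if "x \<in> carrier S" "y \<in> carrier S" for x y
    using inv_hom_image_semigroup[OF assms(2)] that by (simp add: inv_hom_def)
  have star_h: "star (image_semigroup S h) (h x) = h (star S x)" if "x \<in> carrier S" for x
    using inv_hom_image_semigroup[OF assms(2)] that by (simp add: inv_hom_def)
  have car: "carrier (image_semigroup S h) = h ` carrier S"
    by (simp add: image_semigroup_def)
  show ?thesis
    by standard (auto simp: car mul_h star_h mul_closed star_closed nonempty mul_assoc star_star star_mul)
qed

text \<open>Assignments into the image lift to \<open>S\<close> through representatives, so validity
  can be tested in \<open>S\<close> modulo the kernel of \<open>h\<close>.\<close>

lemma satisfies_image_semigroup:
  fixes h :: "'a \<Rightarrow> 'b"
  assumes "involution_semigroup S" "op_compatible S h"
  shows "satisfies (image_semigroup S h) e \<longleftrightarrow>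
    (\<forall>f. range f \<subseteq> carrier S \<longrightarrow> h (term_value S f (fst e)) = h (term_value S f (snd e)))"
proof -
  have hom: "term_value (image_semigroup S h) (h \<circ> f) t = h (term_value S f t)"
    if "range f \<subseteq> carrier S" for f t
    using term_value_hom[OF assms(1) inv_hom_image_semigroup[OF assms(2)] that] .
  have car: "carrier (image_semigroup S h) = h ` carrier S"
    by (simp add: image_semigroup_def)
  show ?thesis
  proof
    assume sat: "satisfies (image_semigroup S h) e"
    show "\<forall>f. range f \<subseteq> carrier S \<longrightarrow> h (term_value S f (fst e)) = h (term_value S f (snd e))"
    proof (intro allI impI)
      fix f :: "nat \<Rightarrow> 'a" assume f: "range f \<subseteq> carrier S"
      then have "range (h \<circ> f) \<subseteq> carrier (image_semigroup S h)" by (auto simp: car)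
      then show "h (term_value S f (fst e)) = h (term_value S f (snd e))"
        using sat unfolding satisfies_def hom[OF f, symmetric] by blast
    qed
  next
    assume eq: "\<forall>f. range f \<subseteq> carrier S \<longrightarrow> h (term_value S f (fst e)) = h (term_value S f (snd e))"
    show "satisfies (image_semigroup S h) e"
      unfolding satisfies_def
    proof (intro allI impI)
      fix k :: "nat \<Rightarrow> 'b" assume k: "range k \<subseteq> carrier (image_semigroup S h)"
      define f where "f i = inv_into (carrier S) h (k i)" for i
      have f: "range f \<subseteq> carrier S"
        using k by (auto simp: f_def car intro!: inv_into_into)
      have "h \<circ> f = k"
        using k by (auto simp: f_def car fun_eq_iff intro!: f_inv_into_f)
      then show "term_value (image_semigroup S h) k (fst e) = term_value (image_semigroup S h) k (snd e)"
        using eq f hom[OF f] by simp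
    qed
  qed
qed

text \<open>Words over variables and starred variables; the letter \<open>(True, i)\<close> is the star of
  \<open>(False, i)\<close>.\<close>

definition word_star :: "(bool \<times> nat) list \<Rightarrow> (bool \<times> nat) list" where
  "word_star w = rev (map (\<lambda>(b, i). (\<not> b, i)) w)"

text \<open>The free involution semigroup on countably many variables.\<close>

definition words :: "(bool \<times> nat) list inv_semigroup" where
  "words = \<lparr>carrier = {w. w \<noteq> []}, mul = (@), star = word_star\<rparr>"

lemma word_star_word_star [simp]: "word_star (word_star w) = w"
  by (simp add: word_star_def rev_map comp_def split_beta)

lemma word_star_append: "word_star (u @ v) = word_star v @ word_star u"
  by (simp add: word_star_def)

lemma word_star_eq_Nil_iff [simp]: "word_star w = [] \<longleftrightarrow> w = []"
  by (simp add: word_star_def)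

lemma words_simps [simp]:
  "carrier words = {w. w \<noteq> []}" "mul words u v = u @ v" "star words u = word_star u"
  by (simp_all add: words_def)

lemma involution_semigroup_words: "involution_semigroup words"
  by standard (auto simp: word_star_append)

lemma word_star_concat_map: "word_star (concat (map f p)) = concat (map (\<lambda>i. word_star (f i)) (rev p))"
proof (induction p)
  case Nil
  show ?case by (simp add: word_star_def)
qed (simp add: word_star_append)

text \<open>No term denotes the empty word; \<open>Var 0\<close> is a dummy value there.\<close>

fun word_term :: "nat list \<Rightarrow> inv_term" where
  "word_term [] = Var 0"
| "word_term [i] = Var i"
| "word_term (i # p) = Mul (Var i) (word_term p)"

lemma term_value_word_term: "p \<noteq> [] \<Longrightarrow> term_value words f (word_term p) = concat (map f p)"
  by (induction p rule: word_term.induct) auto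

section \<open>Invariants of the Baxter congruence and isoterms\<close>

text \<open>The leading block alone is not compatible with products, since it may run on into the
  second factor. Equal content repairs this: it happens for \<open>x\<close> and \<open>y\<close>
  simultaneously, and then \<open>x = y\<close>.\<close>

lemma takeWhile_append_cong:
  assumes "mset x = mset y" "takeWhile P x = takeWhile P y" "takeWhile P x' = takeWhile P y'"
  shows "takeWhile P (x @ x') = takeWhile P (y @ y')"
proof -
  have "set x = set y" using assms(1) by (metis set_mset_mset)
  moreover have "x = y" if "\<forall>z\<in>set x. P z"
    using that assms(2) calculation by (metis takeWhile_eq_all_conv)
  ultimately show ?thesis using assms(2,3) by (auto simp: takeWhile_append)
qed

text \<open>In both families of relations the first letter exceeds 1 and the last is below
  \<open>n\<close>, so both blocks are empty on either side.\<close>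

lemma baxt_congruence_invariants:
  assumes "(x, y) \<in> baxt_congruence n"
  shows "mset x = mset y \<and> takeWhile (\<lambda>z. z = 1) x = takeWhile (\<lambda>z. z = 1) y
    \<and> takeWhile (\<lambda>z. z = n) (rev x) = takeWhile (\<lambda>z. z = n) (rev y)"
  using assms unfolding baxt_congruence_def
proof (induction rule: free_congruence.induct)
  case (gen x y)
  from gen(1) show ?case
    unfolding baxt_relations_def by (auto simp: takeWhile_append takeWhile_tail)
next
  case (app x y x' y')
  then show ?case
    by (auto intro!: takeWhile_append_cong)
qed auto

text \<open>Evaluation in \<open>baxt n\<close> at the level of representatives. Values of
  \<open>g\<close> may be empty, as \<open>baxt n\<close> is a monoid, so letters can be
  erased.\<close>

definition subst :: "nat \<Rightarrow> (nat \<Rightarrow> nat list) \<Rightarrow> (bool \<times> nat) list \<Rightarrow> nat list" where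
  "subst n g w = concat (map (\<lambda>(b, i). if b then sharp_word n (g i) else g i) w)"

lemma subst_simps [simp]:
  "subst n g [] = []"
  "subst n g ((b, i) # w) = (if b then sharp_word n (g i) else g i) @ subst n g w"
  "subst n g (u @ v) = subst n g u @ subst n g v"
  by (simp_all add: subst_def)

lemma subst_lists:
  assumes "range g \<subseteq> lists {1..n}"
  shows "subst n g w \<in> lists {1..n}"
proof (induction w)
  case (Cons l w)
  obtain b i where "l = (b, i)" by fastforce
  moreover have "g i \<in> lists {1..n}" using assms by auto
  ultimately show ?case
    using Cons sharp_word_lists by simp
qed simp

lemma subst_word_star:
  assumes "range g \<subseteq> lists {1..n}"
  shows "subst n g (word_star w) = sharp_word n (subst n g w)"
proof (induction w)
  case Nil
  show ?case by (simp add: word_star_def sharp_word_def)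
next
  case (Cons l w)
  obtain b i where l: "l = (b, i)" by fastforce
  have "g i \<in> lists {1..n}" using assms by auto
  moreover have "word_star (l # w) = word_star w @ [(\<not> b, i)]"
    by (simp add: word_star_def l)
  ultimately show ?case
    using Cons by (simp add: l sharp_word_append sharp_word_sharp_word)
qed

lemma inv_hom_subst:
  assumes "range g \<subseteq> lists {1..n}"
  shows "inv_hom words (baxt n) (\<lambda>w. baxt_congruence n `` {subst n g w})"
  unfolding inv_hom_def
  using subst_lists[OF assms] subst_word_star[OF assms]
  by (auto simp: baxt_mul_class baxt_star_class simp del: in_lists_conv_set)
    (simp add: baxt_def quotientI del: in_lists_conv_set)

lemma baxt_identity_subst:
  assumes "satisfies (baxt n) (s, t)" "range f \<subseteq> carrier words" "range g \<subseteq> lists {1..n}"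
  shows "(subst n g (term_value words f s), subst n g (term_value words f t)) \<in> baxt_congruence n"
proof -
  define h where "h w = baxt_congruence n `` {subst n g w}" for w
  have hom: "inv_hom words (baxt n) h"
    using inv_hom_subst[OF assms(3)] unfolding h_def[abs_def] .
  then have "range (h \<circ> f) \<subseteq> carrier (baxt n)"
    using assms(2) by (auto simp: inv_hom_def)
  then have "h (term_value words f s) = h (term_value words f t)"
    using assms(1) unfolding satisfies_def fst_conv snd_conv
      term_value_hom[OF involution_semigroup_words hom assms(2), symmetric] by blast
  then show ?thesis
    using eq_equiv_class[OF _ equiv_baxt_congruence] subst_lists[OF assms(3)] by (simp add: h_def)
qed

text \<open>Substituting 1 for one variable compares contents, which rules out starred letters in
  the other side. Erasing all but two variables and sending these to 1 and \<open>n\<close> compares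
  the leading and trailing blocks of each two-letter projection; these determine the projections, as
  letters occur at most twice.\<close>

lemma baxt_isoterm:
  assumes "2 \<le> n" "satisfies (baxt n) (s, t)" "range f \<subseteq> carrier words"
    and "term_value words f s = map (Pair False) u" "\<And>x. count_list u x \<le> 2"
  shows "term_value words f t = map (Pair False) u"
proof -
  define U where "U = term_value words f s"
  define V where "V = term_value words f t"
  have "n \<noteq> 1" using assms(1) by simp
  have inv: "mset (subst n g U) = mset (subst n g V)"
    "takeWhile (\<lambda>z. z = 1) (subst n g U) = takeWhile (\<lambda>z. z = 1) (subst n g V)"
    "takeWhile (\<lambda>z. z = n) (rev (subst n g U)) = takeWhile (\<lambda>z. z = n) (rev (subst n g V))"
    if "range g \<subseteq> lists {1..n}" for g
    using baxt_congruence_invariants[OF baxt_identity_subst[OF assms(2,3) that]]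
    by (simp_all add: U_def V_def)
  have "count_list U (b, i) = count_list V (b, i)" for b i
  proof -
    \<comment> \<open>As the involution sends 1 to \<open>n\<close>, the letter 1 counts plain
      occurrences of the variable \<open>i\<close> and the letter \<open>n\<close> counts starred
      ones.\<close>
    define g where "g j = (if j = i then [1::nat] else [])" for j
    have "range g \<subseteq> lists {1..n}" using assms(1) by (auto simp: g_def)
    moreover have "count_list (subst n g W) 1 = count_list W (False, i)" for W
      using \<open>n \<noteq> 1\<close> by (induction W) (auto simp: g_def sharp_word_def split: if_splits)
    moreover have "count_list (subst n g W) n = count_list W (True, i)" for W
      using \<open>n \<noteq> 1\<close> by (induction W) (auto simp: g_def sharp_word_def split: if_splits)
    ultimately show ?thesis using inv(1)[of g] by (metis (full_types) count_mset)
  qed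
  then have "mset U = mset V"
    by (intro multiset_eqI) (simp add: count_mset split_paired_all)
  then have "set V = set U" by (metis set_mset_mset)
  then have "\<forall>l\<in>set V. fst l = False" using assms(4) by (auto simp: U_def)
  then have V: "V = map (Pair False) (map snd V)"
    by (auto simp: map_idI comp_def split_beta prod_eq_iff intro!: map_idI[symmetric])
  define v where "v = map snd V"
  have UV: "U = map (Pair False) u" "V = map (Pair False) v"
    using assms(4) V by (simp_all add: U_def v_def)
  have "mset u = mset v"
    using arg_cong[OF \<open>mset U = mset V\<close>, of "image_mset snd"] by (simp add: UV multiset.map_comp comp_def)
  \<comment> \<open>The recoding \<open>c\<close> need not be injective: both blocks consist of
    copies of \<open>x\<close>, so their lengths decide.\<close>
  have tw: "takeWhile (\<lambda>z. z = x) u' = takeWhile (\<lambda>z. z = x) v'"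
    if "map c (takeWhile (\<lambda>z. z = x) u') = map c (takeWhile (\<lambda>z. z = x) v')"
    for c :: "nat \<Rightarrow> nat" and x and u' v' :: "nat list"
  proof -
    have "set (takeWhile (\<lambda>z. z = x) w) \<subseteq> {x}" for w
      by (auto dest: set_takeWhileD)
    then show ?thesis
      using that by (metis length_map replicate_if_set_subset)
  qed
  have pair: "filter (\<lambda>z. z \<in> {x, y}) u = filter (\<lambda>z. z \<in> {x, y}) v" if "x \<noteq> y" for x y
  proof -
    \<comment> \<open>Substitute 1 for one of the two letters, n for the other and the empty word elsewhere.\<close>
    define F where "F w = filter (\<lambda>z. z \<in> {x, y}) w" for w
    have sub: "subst n (\<lambda>j. if j = p then [1] else if j = q then [n] else []) (map (Pair False) w)
        = map (\<lambda>z. if z = p then 1 else n) (F w)"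
      if "{p, q} = {x, y}" for p q w
      using that by (induction w) (auto simp: F_def)
    have rng: "range (\<lambda>j. if j = p then [1] else if j = q then [n] else []) \<subseteq> lists {1..n}" for p q :: nat
      using assms(1) by auto
    have is_1: "(\<lambda>z. (if z = x then 1 else n) = 1) = (\<lambda>z. z = x)"
      using \<open>n \<noteq> 1\<close> by auto
    have head: "takeWhile (\<lambda>z. z = x) (F u) = takeWhile (\<lambda>z. z = x) (F v)"
      using inv(2)[OF rng[of x y]] unfolding UV sub[OF HOL.refl] takeWhile_map comp_def is_1
      by (rule tw)
    \<comment> \<open>The trailing invariant sees the letter \<open>n\<close>, so the roles are
      exchanged: now \<open>x\<close> goes to \<open>n\<close> and \<open>y\<close> to 1, and both
      blocks concern \<open>x\<close>.\<close>
    have last: "takeWhile (\<lambda>z. z = x) (rev (F u)) = takeWhile (\<lambda>z. z = x) (rev (F v))"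
    proof (rule tw[where c = "\<lambda>z. if z = y then 1 else n"])
      have mem: "z = x \<or> z = y" if "z \<in> set (F w)" for z w
        using that by (auto simp: F_def)
      have "takeWhile (\<lambda>z. (if z = y then 1 else n) = n) (rev (F w)) = takeWhile (\<lambda>z. z = x) (rev (F w))" for w
        using \<open>n \<noteq> 1\<close> \<open>x \<noteq> y\<close> by (intro takeWhile_cong) (auto dest: mem)
      then show "map (\<lambda>z. if z = y then 1 else n) (takeWhile (\<lambda>z. z = x) (rev (F u)))
          = map (\<lambda>z. if z = y then 1 else n) (takeWhile (\<lambda>z. z = x) (rev (F v)))"
        using inv(3)[OF rng[of y x]] unfolding UV sub[of y x, OF insert_commute] rev_map takeWhile_map
        by (simp add: comp_def)
    qed
    have mset: "mset (F u) = mset (F v)"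
      using \<open>mset u = mset v\<close> by (simp add: F_def mset_filter)
    have count: "count_list (F u) y \<le> 2"
    proof -
      have "count_list (F w) y = count_list w y" for w
        by (induction w) (auto simp: F_def)
      then show ?thesis using assms(5) by simp
    qed
    have "set (F w) \<subseteq> {x, y}" for w by (auto simp: F_def)
    from two_letter_word_eq[OF that this this mset count head last]
    have "F u = F v" .
    then show ?thesis by (simp add: F_def)
  qed
  have "u = v"
  proof (rule eq_if_filter_pairs_eq)
    fix x y
    show "filter (\<lambda>z. z \<in> {x, y}) u = filter (\<lambda>z. z \<in> {x, y}) v"
    proof (cases "x = y")
      \<comment> \<open>The one-letter projection is read off from a two-letter one;
        \<open>Suc x\<close> is just some other letter.\<close>
      case True
      have "filter (\<lambda>z. z = x) (filter (\<lambda>z. z \<in> {x, Suc x}) u) = filter (\<lambda>z. z = x) (filter (\<lambda>z. z \<in> {x, Suc x}) v)"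
        using pair[of x "Suc x"] by simp
      moreover have "(\<lambda>z. z = x \<and> z \<in> {x, Suc x}) = (\<lambda>z. z = x)" by auto
      ultimately show ?thesis using True by (simp add: conj_commute)
    qed (rule pair)
  qed
  then show ?thesis using UV by (simp add: V_def)
qed

section \<open>Nilpotent Rees quotients in the generated variety\<close>

text \<open>Closed under star and under nonempty factors, so the remaining words form an ideal
  closed under star.\<close>

definition factors :: "nat \<Rightarrow> (bool \<times> nat) list set" where
  "factors r = {w. w \<noteq> [] \<and> (sublist w (map (Pair False) (double_word r))
     \<or> sublist (word_star w) (map (Pair False) (double_word r)))}"

text \<open>The empty word, which is not an element of \<^const>\<open>words\<close>, represents 0.\<close>

definition collapse :: "nat \<Rightarrow> ((bool \<times> nat) list \<Rightarrow> 'a) \<Rightarrow> (bool \<times> nat) list \<Rightarrow> 'a" where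
  "collapse r \<iota> w = \<iota> (if w \<in> factors r then w else [])"

lemma collapse_eq_iff:
  "inj \<iota> \<Longrightarrow> collapse r \<iota> v = collapse r \<iota> w \<longleftrightarrow> v = w \<or> v \<notin> factors r \<and> w \<notin> factors r"
  by (auto simp: collapse_def factors_def inj_eq)

lemma word_star_factors_iff [simp]: "word_star w \<in> factors r \<longleftrightarrow> w \<in> factors r"
  by (auto simp: factors_def)

lemma append_factorsD:
  assumes "u @ v \<in> factors r"
  shows "u \<noteq> [] \<Longrightarrow> u \<in> factors r" "v \<noteq> [] \<Longrightarrow> v \<in> factors r"
  using assms sublist_order.order_trans[of u "u @ v"] sublist_order.order_trans[of v "u @ v"]
    sublist_order.order_trans[of "word_star u" "word_star (u @ v)"]
    sublist_order.order_trans[of "word_star v" "word_star (u @ v)"]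
  by (auto simp: factors_def word_star_append)

lemma op_compatible_collapse:
  assumes "inj \<iota>"
  shows "op_compatible words (collapse r \<iota>)"
proof -
  have append: "u @ v \<notin> factors r" if "u \<noteq> []" "v \<noteq> []" "u \<notin> factors r \<or> v \<notin> factors r" for u v
    using append_factorsD[of u v r] that by blast
  show ?thesis
    unfolding op_compatible_def collapse_eq_iff[OF assms] using append by simp
qed

text \<open>The Rees quotient of the free involution semigroup by the ideal of words outside
  \<open>factors r\<close>, coded into the target type by \<open>\<iota>\<close>.\<close>

definition nil_semigroup :: "nat \<Rightarrow> ((bool \<times> nat) list \<Rightarrow> 'a) \<Rightarrow> 'a inv_semigroup" where
  "nil_semigroup r \<iota> = image_semigroup words (collapse r \<iota>)"

lemma satisfies_nil_semigroup:
  assumes "inj \<iota>"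
  shows "satisfies (nil_semigroup r \<iota>) (s, t) \<longleftrightarrow>
    (\<forall>f. range f \<subseteq> carrier words \<longrightarrow> term_value words f s = term_value words f t
      \<or> term_value words f s \<notin> factors r \<and> term_value words f t \<notin> factors r)"
  unfolding nil_semigroup_def
    satisfies_image_semigroup[OF involution_semigroup_words op_compatible_collapse[OF assms]]
    collapse_eq_iff[OF assms] by simp

text \<open>If one side takes a nonzero value, this value or its star is a factor of w_r, hence an
  isoterm, and the other side takes the same value; in the second case the star is applied to the
  whole identity. Otherwise both sides are 0.\<close>

lemma nil_semigroup_baxt_identity:
  assumes "2 \<le> n" "inj \<iota>" "satisfies (baxt n) (s, t)"
  shows "satisfies (nil_semigroup r \<iota>) (s, t)"
proof -
  have direct: "term_value words f t = term_value words f s"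
    if st: "satisfies (baxt n) (s, t)" "range f \<subseteq> carrier words"
      and sub: "sublist (term_value words f s) (map (Pair False) (double_word r))" for f s t
  proof -
    obtain X Y where "map (Pair False) (double_word r) = X @ term_value words f s @ Y"
      using sub by (auto simp: sublist_def)
    then obtain X' u Y' where u: "double_word r = X' @ u @ Y'" "term_value words f s = map (Pair False) u"
      by (auto simp: map_eq_append_conv append_eq_map_conv)
    have "count_list u x \<le> 2" for x
      using count_list_double_word_le[of r x] by (simp add: u(1))
    then show ?thesis
      using baxt_isoterm[OF assms(1) st u(2)] u(2) by simp
  qed
  have factor: "term_value words f t = term_value words f s"
    if st: "satisfies (baxt n) (s, t)" "range f \<subseteq> carrier words" and "term_value words f s \<in> factors r" for f s t
  proof (cases "sublist (term_value words f s) (map (Pair False) (double_word r))")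
    case True
    then show ?thesis using direct st by blast
  next
    case False
    then have "sublist (term_value words f (Star s)) (map (Pair False) (double_word r))"
      using that(3) by (simp add: factors_def)
    moreover have "satisfies (baxt n) (Star s, Star t)"
      using st(1) by (simp add: satisfies_def)
    ultimately have "term_value words f (Star t) = term_value words f (Star s)"
      using direct st(2) by blast
    then show ?thesis by (metis term_value.simps(3) word_star_word_star words_simps(3))
  qed
  have "satisfies (baxt n) (t, s)"
    using assms(3) by (simp add: satisfies_def)
  then show ?thesis
    unfolding satisfies_nil_semigroup[OF assms(2)] using factor assms(3) by metis
qed

section \<open>The separating identities\<close>

text \<open>The signature has no symbol for 0. Since 0 is the only idempotent of
  \<open>nil_semigroup\<close>, this identity says there that the word always takes the value
  0.\<close>

definition square_identity :: "nat \<Rightarrow> inv_term \<times> inv_term" where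
  "square_identity r = (word_term (double_word r),
     Mul (word_term (double_word r)) (word_term (double_word r)))"

lemma double_word_nonempty: "double_word r \<noteq> []"
  using length_double_word[of r] by auto

lemma nil_semigroup_square_identity:
  assumes "inj \<iota>" "1 \<le> r" "q \<noteq> r"
  shows "satisfies (nil_semigroup r \<iota>) (square_identity q)"
proof -
  have val: "concat (map f (double_word q)) \<notin> factors r" if f: "range f \<subseteq> carrier words" for f
  proof -
    \<comment> \<open>Stated for any \<open>p\<close> with the length and letter counts of w_q,
      since the star of an instance of w_q is an instance of the reversed word.\<close>
    have free: "\<not> sublist (concat (map f p)) (map (Pair False) (double_word r))"
      if f: "\<And>i. f i \<noteq> []" and p: "length p = length (double_word q)"
        "\<And>x. count_list p x = count_list (double_word q) x" for f p
    proof
      assume "sublist (concat (map f p)) (map (Pair False) (double_word r))"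
      then obtain X Y where "map (Pair False) (double_word r) = X @ concat (map f p) @ Y"
        by (auto simp: sublist_def)
      \<comment> \<open>Forgetting the star marks turns \<open>f\<close> into a substitution of
        plain words.\<close>
      from arg_cong[OF this, of "map snd"]
      have "double_word r = map snd X @ concat (map (\<lambda>i. map snd (f i)) p) @ map snd Y"
        by (simp add: comp_def map_concat)
      then have "sublist (concat (map (\<lambda>i. map snd (f i)) p)) (double_word r)"
        by (auto simp: sublist_def)
      moreover have "2 \<le> count_list p i" if "i \<in> set p" for i
        using count_list_ge_1[OF that] by (simp add: p(2) count_list_double_word split: if_splits)
      moreover have "p \<noteq> []" "length p \<noteq> length (double_word r)"
        using p(1) assms(3) by (auto simp: length_double_word)
      ultimately show False
        using double_word_instance_free[OF assms(2), of p "\<lambda>i. map snd (f i)"] f by simp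
    qed
    have "\<not> sublist (concat (map f (double_word q))) (map (Pair False) (double_word r))"
      using f by (intro free) auto
    moreover have "\<not> sublist (word_star (concat (map f (double_word q)))) (map (Pair False) (double_word r))"
      unfolding word_star_concat_map using f by (intro free) (auto simp: count_list_rev)
    ultimately show ?thesis by (simp add: factors_def)
  qed
  have "concat (map f (double_word q)) @ concat (map f (double_word q)) \<notin> factors r"
    if f: "range f \<subseteq> carrier words" for f
    using append_factorsD(1) val[OF f] by (metis append_Nil)
  then show ?thesis
    unfolding square_identity_def satisfies_nil_semigroup[OF assms(1)] term_value.simps
      term_value_word_term[OF double_word_nonempty] words_simps(2)
    using val by blast
qed

lemma nil_semigroup_not_square_identity:
  assumes "inj \<iota>"
  shows "\<not> satisfies (nil_semigroup r \<iota>) (square_identity r)"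
proof -
  define f where "f i = [(False, i)]" for i :: nat
  have val: "concat (map f p) = map (Pair False) p" for p
    by (induction p) (auto simp: f_def)
  have "range f \<subseteq> carrier words" by (auto simp: f_def)
  moreover have "map (Pair False) (double_word r) \<in> factors r"
    by (simp add: factors_def double_word_nonempty)
  moreover have "map (Pair False) (double_word r) \<noteq> map (Pair False) (double_word r) @ map (Pair False) (double_word r)"
    by (simp add: double_word_nonempty)
  ultimately show ?thesis
    unfolding square_identity_def satisfies_nil_semigroup[OF assms] term_value.simps
      term_value_word_term[OF double_word_nonempty] words_simps(2)
    using val by metis
qed

section \<open>Counting subvarieties\<close>

instance inv_term :: countable
  by countable_datatype

lemma subvarieties_lepoll: "subvarieties V \<lesssim> (UNIV :: nat set set)"
proof -
  have "subvarieties V \<subseteq> models ` (UNIV :: (inv_term \<times> inv_term) set set)"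
    by (auto simp: subvarieties_def variety_def)
  then have "subvarieties V \<lesssim> (UNIV :: (inv_term \<times> inv_term) set set)"
    by (meson image_lepoll lepoll_trans subset_imp_lepoll)
  also have "\<dots> \<lesssim> (UNIV :: nat set set)"
    unfolding lepoll_def using inj_on_image_Pow[OF inj_to_nat] by auto
  finally show ?thesis .
qed

theorem theorem5p8:
  fixes n :: nat
  assumes "n \<ge> 2"
    and "infinite (UNIV :: 'a set)"
  shows "subvarieties (generated_variety (baxt n) :: 'a inv_semigroup set) \<approx> (UNIV :: nat set set)"
proof (rule lepoll_antisym[OF subvarieties_lepoll])
  obtain \<kappa> :: "nat \<Rightarrow> 'a" where "inj \<kappa>"
    using assms(2) by (meson infinite_countable_subset)
  \<comment> \<open>Words are countable, so the Rees quotients fit into every infinite type.\<close>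
  define \<iota> :: "(bool \<times> nat) list \<Rightarrow> 'a" where "\<iota> = \<kappa> \<circ> to_nat"
  have \<iota>: "inj \<iota>" using \<open>inj \<kappa>\<close> by (simp add: \<iota>_def inj_compose)
  \<comment> \<open>The shift to \<open>Suc k\<close> avoids r = 0, where w_0 = 0 1 0 1 repeats the
    factor 0 1.\<close>
  define W :: "nat set \<Rightarrow> 'a inv_semigroup set" where
    "W J = models (identities (baxt n) \<union> (\<lambda>k. square_identity (Suc k)) ` J)" for J
  \<comment> \<open>The quotient for \<open>Suc k\<close> tests whether \<open>k\<close> lies in
    \<open>J\<close>, so \<open>W J\<close> determines \<open>J\<close>.\<close>
  have mem: "nil_semigroup (Suc k) \<iota> \<in> W J \<longleftrightarrow> k \<notin> J" for k J
  proof -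
    have "involution_semigroup (nil_semigroup (Suc k) \<iota>)"
      unfolding nil_semigroup_def
      by (rule involution_semigroup_image[OF involution_semigroup_words op_compatible_collapse[OF \<iota>]])
    moreover have "satisfies (nil_semigroup (Suc k) \<iota>) e" if "e \<in> identities (baxt n)" for e
      using nil_semigroup_baxt_identity[OF assms(1) \<iota>, of "fst e" "snd e"] that
      by (simp add: identities_def)
    moreover have "satisfies (nil_semigroup (Suc k) \<iota>) (square_identity (Suc j)) \<longleftrightarrow> j \<noteq> k" for j
      using nil_semigroup_square_identity[OF \<iota>, of "Suc k" "Suc j"]
        nil_semigroup_not_square_identity[OF \<iota>, of "Suc k"] by auto
    ultimately show ?thesis by (simp add: W_def models_def ball_Un) blast
  qed
  have "inj W"
  proof (rule injI)
    fix J K assume "W J = W K"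
    then show "J = K" using mem by blast
  qed
  moreover have "W J \<in> subvarieties (generated_variety (baxt n))" for J
    by (auto simp: W_def subvarieties_def variety_def generated_variety_def models_def)
  ultimately show "(UNIV :: nat set set) \<lesssim> subvarieties (generated_variety (baxt n) :: 'a inv_semigroup set)"
    unfolding lepoll_def by blast
qed

end
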